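(* Let $k \geq 1$ and let $r \colon \{0,1,\dots,k\} \to \mathbb{R}_{\geq 0}$ be monotone nondecreasing with $r(0)=0$. Assume that $r(1) \geq r(i)/i$ for every $i \in \{1,2,\dots,k\}$. Then for every instance of $\textsc{swamp}(r)$ there is an optimal solution consisting of a single node.
   Context: An instance of $\textsc{swamp}(r)$ is a hypergraph $H=(V,E,w)$ with maximum hyperedge size $k$ and nonnegative edge weights $w(e)\ge 0$, where every hyperedge uses the same reward function $r$ (restricted to $\{0,\dots,|e|\}$). For a nonempty $S\subseteq V$ let $f(S)=\sum_{e\in E} w(e)\, r(|e\cap S|)$ and $\Gamma(S)=f(S)/|S|$. The problem asks for a nonempty $S\subseteq V$ maximizing $\Gamma(S)$; such a maximizer is an optimal solution. *)

theory Defs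
  imports Complex_Main
begin

definition swamp_instance :: "nat \<Rightarrow> 'a set \<Rightarrow> 'a set set \<Rightarrow> ('a set \<Rightarrow> real) \<Rightarrow> bool" where
  "swamp_instance k V E w \<longleftrightarrow>
     finite V \<and> V \<noteq> {} \<and> E \<subseteq> Pow V \<and>
     (\<forall>e\<in>E. card e \<le> k) \<and> (\<forall>e\<in>E. w e \<ge> 0)"

definition swamp_f :: "'a set set \<Rightarrow> ('a set \<Rightarrow> real) \<Rightarrow> (nat \<Rightarrow> real) \<Rightarrow> 'a set \<Rightarrow> real" where
  "swamp_f E w r S = (\<Sum>e\<in>E. w e * r (card (e \<inter> S)))"

definition swamp_Gamma :: "'a set set \<Rightarrow> ('a set \<Rightarrow> real) \<Rightarrow> (nat \<Rightarrow> real) \<Rightarrow> 'a set \<Rightarrow> real" where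
  "swamp_Gamma E w r S = swamp_f E w r S / real (card S)"

definition swamp_optimal ::
    "'a set \<Rightarrow> 'a set set \<Rightarrow> ('a set \<Rightarrow> real) \<Rightarrow> (nat \<Rightarrow> real) \<Rightarrow> 'a set \<Rightarrow> bool" where
  "swamp_optimal V E w r S \<longleftrightarrow>
     is_arg_max (swamp_Gamma E w r) (\<lambda>T. T \<subseteq> V \<and> T \<noteq> {}) S"

end

theory Submission
  imports Defs
begin

text \<open>The hypothesis says \<open>r i \<le> i * r 1\<close>, so the reward of a set is at most the sum of the
  rewards of its nodes. Hence the density of \<open>S\<close> is at most the average, and so at most the
  maximum, of the densities of single nodes.\<close>

text \<open>Each \<open>card (e \<inter> {v})\<close> is 1 or 0 according to whether
  \<open>v\<close> lies in \<open>e\<close>, and \<open>r 0 = 0\<close> removes the nodes outside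
  \<open>e\<close>.\<close>

lemma sum_reward_singletons:
  fixes r :: "nat \<Rightarrow> real"
  assumes "finite S" and "r 0 = 0"
  shows "(\<Sum>v\<in>S. r (card (e \<inter> {v}))) = real (card (e \<inter> S)) * r 1"
proof -
  have "(\<Sum>v\<in>S. r (card (e \<inter> {v}))) = (\<Sum>v\<in>S. if v \<in> e then r 1 else 0)"
    using assms(2) by (intro sum.cong) auto
  also have "\<dots> = (\<Sum>v\<in>S \<inter> e. r 1)"
    using assms(1) by (rule sum.inter_restrict[symmetric])
  finally show ?thesis
    by (simp add: Int_commute)
qed

text \<open>The bound \<open>r i \<le> i * r 1\<close> is applied edge by edge with
  \<open>i = card (e \<inter> S)\<close>; weights are nonnegative, so it survives summation, and
  exchanging the sums over edges and nodes regroups the result by node.\<close>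

lemma swamp_f_le_sum_singletons:
  fixes r :: "nat \<Rightarrow> real"
  assumes inst: "swamp_instance k V E w" and "S \<subseteq> V" and r0: "r 0 = 0"
    and r1: "\<forall>i\<in>{1..k}. r 1 \<ge> r i / real i"
  shows "swamp_f E w r S \<le> (\<Sum>v\<in>S. swamp_f E w r {v})"
proof -
  have "finite S"
    using inst \<open>S \<subseteq> V\<close> unfolding swamp_instance_def by (auto intro: finite_subset)
  have r_le: "r i \<le> real i * r 1" if "i \<le> k" for i
  proof (cases "i = 0")
    case False
    then have "r i / real i \<le> r 1"
      using r1 that by auto
    then show ?thesis
      using False by (simp add: field_simps)
  qed (simp add: r0)
  have "swamp_f E w r S \<le> (\<Sum>e\<in>E. w e * (real (card (e \<inter> S)) * r 1))"
    unfolding swamp_f_def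
  proof (intro sum_mono mult_left_mono r_le)
    \<comment> \<open>Infinite sets have \<open>card\<close> 0, so monotonicity of
      \<open>card\<close> needs \<open>finite e\<close>, which follows from
      \<open>e \<subseteq> V\<close>.\<close>
    fix e assume "e \<in> E"
    then have "finite e" "card e \<le> k"
      using inst unfolding swamp_instance_def by (auto intro: finite_subset[of e V])
    then show "card (e \<inter> S) \<le> k"
      by (meson Int_lower1 card_mono order_trans)
  qed (use inst in \<open>auto simp: swamp_instance_def\<close>)
  also have "\<dots> = (\<Sum>e\<in>E. \<Sum>v\<in>S. w e * r (card (e \<inter> {v})))"
    using sum_reward_singletons[where r = r, OF \<open>finite S\<close> r0] by (simp flip: sum_distrib_left)
  also have "\<dots> = (\<Sum>v\<in>S. swamp_f E w r {v})"
    unfolding swamp_f_def by (rule sum.swap)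
  finally show ?thesis .
qed

theorem theorem2:
  fixes k :: nat and r :: "nat \<Rightarrow> real"
    and V :: "'a set" and E :: "'a set set" and w :: "'a set \<Rightarrow> real"
  assumes "k \<ge> 1"
    and "\<forall>i\<in>{0..k}. r i \<ge> 0"
    and "mono_on {0..k} r"
    and "r 0 = 0"
    and "\<forall>i\<in>{1..k}. r 1 \<ge> r i / real i"
    and "swamp_instance k V E w"
  shows "\<exists>v\<in>V. swamp_optimal V E w r {v}"
proof -
  have V: "finite V" "V \<noteq> {}"
    using assms(6) by (auto simp: swamp_instance_def)
  \<comment> \<open>On singletons the denominator of \<open>swamp_Gamma\<close> is 1, so
    \<open>m\<close> is also the largest density of a single node.\<close>
  define m where "m = Max ((\<lambda>v. swamp_f E w r {v}) ` V)"
  have "m \<in> (\<lambda>v. swamp_f E w r {v}) ` V"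
    unfolding m_def using V by (intro Max_in) auto
  then obtain v where v: "v \<in> V" "m = swamp_f E w r {v}"
    by auto
  have max: "swamp_f E w r {u} \<le> m" if "u \<in> V" for u
    unfolding m_def using V that by (intro Max_ge) auto
  have "swamp_Gamma E w r T \<le> swamp_Gamma E w r {v}" if T: "T \<subseteq> V" "T \<noteq> {}" for T
  proof -
    \<comment> \<open>Positivity allows the bound \<open>card T * m\<close> on
      \<open>swamp_f E w r T\<close> to be divided by \<open>card T\<close>.\<close>
    have "card T > 0"
      using V T by (simp add: card_gt_0_iff finite_subset)
    have "swamp_f E w r T \<le> (\<Sum>u\<in>T. swamp_f E w r {u})"
      using swamp_f_le_sum_singletons[where r = r, OF assms(6) T(1) assms(4,5)] .
    also have "\<dots> \<le> real (card T) * m"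
      using T max by (intro sum_bounded_above) auto
    finally show ?thesis
      using \<open>card T > 0\<close> v by (simp add: swamp_Gamma_def field_simps)
  qed
  then show ?thesis
    using v(1) by (auto simp: swamp_optimal_def is_arg_max_linorder)
qed

end
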